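(* Let $n\ge 2$ be an integer. Define unit vectors $a_0,a_1,\dots,a_{n-1}\in\mathbb{R}^n$ by $$a_j=(\cos\theta_j,\sin\theta_j,0,\dots,0),\qquad \theta_j=\frac{j\pi}{n}\ \text{ if } n \text{ is odd},\qquad \theta_j=\frac{(2j+1)\pi}{2n}\ \text{ if } n\text{ is even},$$ for $0\le j\le n-1$, and let $P_n(x)=\langle x,a_0\rangle\langle x,a_1\rangle\cdots\langle x,a_{n-1}\rangle$. Then $$\|P_n\|_{S_{\mathbb{C}^n}}=2^{\frac{n-2}{2}}\,\|P_n\|_{S_{\mathbb{R}^n}}.$$
   Context: For $\mathbb{K}=\mathbb{R}$ or $\mathbb{C}$, $S_{\mathbb{K}^n}$ is the Euclidean unit sphere of $\mathbb{K}^n$ and $\|P_n\|_{S_{\mathbb{K}^n}}=\sup\{|P_n(\xi)|:\xi\in S_{\mathbb{K}^n}\}$. On $\mathbb{C}^n$ the polynomial $P_n$ is evaluated by the same polynomial formula, i.e. $\langle x,a_j\rangle=\sum_{k=1}^n x_k a_j^k$ for $x=(x_1,\dots,x_n)\in\mathbb{C}^n$ and $a_j=(a_j^1,\dots,a_j^n)\in\mathbb{R}^n$. *)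

theory Defs
  imports "HOL-Analysis.L2_Norm" "Jordan_Normal_Form.Matrix"
begin

definition theta :: "nat \<Rightarrow> nat \<Rightarrow> real" where
  "theta n j = (if odd n then real j * pi / real n
                else (2 * real j + 1) * pi / (2 * real n))"

text \<open>Coordinates are numbered from 0 here, so \<open>avec n j\<close> is
  \<open>(cos \<theta>, sin \<theta>, 0, \<dots>, 0)\<close> in real n-space.\<close>

definition avec :: "nat \<Rightarrow> nat \<Rightarrow> real vec" where
  "avec n j = vec n (\<lambda>k. if k = 0 then cos (theta n j)
                      else if k = 1 then sin (theta n j) else 0)"

text \<open>The same formula serves the real and the complex scalars. The scalar product of
  \<open>Jordan_Normal_Form.Matrix\<close> is bilinear (no conjugation), as required over the complex
  numbers.\<close>

definition Pn :: "nat \<Rightarrow> 'a::real_normed_field vec \<Rightarrow> 'a" where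
  "Pn n x = (\<Prod>j<n. x \<bullet> map_vec of_real (avec n j))"

definition unit_sphere :: "nat \<Rightarrow> 'a::real_normed_field vec set" where
  "unit_sphere n = {x \<in> carrier_vec n. L2_set (\<lambda>k. norm (x $ k)) {..<n} = 1}"

definition sphere_norm :: "nat \<Rightarrow> ('a::real_normed_field vec \<Rightarrow> 'a) \<Rightarrow> real" where
  "sphere_norm n f = (SUP x \<in> unit_sphere n. norm (f x))"

end

theory Submission
  imports Defs "HOL-Computational_Algebra.Polynomial"
begin

text \<open>Only the first two coordinates \<open>z, w\<close> of \<open>x\<close> enter. With \<open>u = z - \<i> w\<close> and
  \<open>v = z + \<i> w\<close> each factor is \<open>(u e\<^sup>i\<^sup>\<theta> + v e\<^sup>-\<^sup>i\<^sup>\<theta>) / 2\<close>, and the numbers \<open>- e\<^sup>2\<^sup>i\<^sup>\<theta>\<close> are the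
  roots of \<open>X\<^sup>n + 1\<close>, so \<open>\<bar>P\<^sub>n(x)\<bar> = \<bar>u\<^sup>n + v\<^sup>n\<bar> / 2\<^sup>n\<close>. As \<open>\<bar>u\<bar>\<^sup>2 + \<bar>v\<bar>\<^sup>2 = 2 (\<bar>z\<bar>\<^sup>2 + \<bar>w\<bar>\<^sup>2)\<close>, the
  complex maximum is \<open>2\<^sup>-\<^sup>n\<^sup>/\<^sup>2\<close>, attained where \<open>v = 0\<close>. For real \<open>x\<close> moreover \<open>\<bar>u\<bar> = \<bar>v\<bar>\<close>, and
  the maximum is \<open>2\<^sup>1\<^sup>-\<^sup>n\<close>, attained where \<open>w = 0\<close>.\<close>

text \<open>For either parity \<open>2 * theta n j\<close> is \<open>2 * theta n 0\<close> plus
  \<open>j\<close> steps of \<open>2 * pi / n\<close>. The points are thus a rotated copy of the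
  \<open>n\<close>-th roots of unity, and the nonzero common factor cancels.\<close>

lemma inj_on_neg_cis_theta:
  assumes "n > 0"
  shows "inj_on (\<lambda>j. - cis (2 * theta n j)) {..<n}"
proof -
  have shift: "cis (2 * theta n j) = cis (2 * theta n 0) * cis (2 * pi * real j / real n)" for j
    unfolding cis_mult by (rule arg_cong[of _ _ cis]) (use assms in \<open>auto simp: theta_def field_simps\<close>)
  have "inj_on (\<lambda>j. cis (2 * pi * real j / real n)) {..<n}"
    using bij_betw_roots_unity[OF assms] by (rule bij_betw_imp_inj_on)
  then show ?thesis
    unfolding inj_on_def by (subst shift, subst (2) shift) simp
qed

text \<open>This is where the two cases of \<open>theta\<close> meet. For odd \<open>n\<close> the
  value -1 comes from the sign, since \<open>(-1) ^ n = -1\<close>; for even \<open>n\<close> the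
  sign vanishes and the half-step in the angle contributes \<open>cis pi\<close>.\<close>

lemma neg_cis_theta_power:
  assumes "n > 0"
  shows "(- cis (2 * theta n j)) ^ n = -1"
proof (cases "odd n")
  case True
  then have "cis (2 * theta n j) ^ n = cis (2 * pi * real j)"
    unfolding Complex.DeMoivre using assms
    by (intro arg_cong[of _ _ cis]) (auto simp: theta_def)
  also have "\<dots> = 1"
    by (simp add: cis_multiple_2pi)
  finally show ?thesis
    using True by simp
next
  case False
  then have "cis (2 * theta n j) ^ n = cis (2 * pi * real j + pi)"
    unfolding Complex.DeMoivre using assms
    by (intro arg_cong[of _ _ cis]) (auto simp: theta_def field_simps)
  also have "\<dots> = -1"
    unfolding cis_mult[symmetric] by (simp add: cis_multiple_2pi)
  finally show ?thesis
    using False by simp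
qed

lemma prod_diff_neg_cis_theta:
  assumes "n > 0"
  shows "(\<Prod>j<n. y + cis (2 * theta n j)) = y ^ n + 1"
proof -
  let ?d = "\<lambda>j. - cis (2 * theta n j)"
  let ?p = "\<Prod>j<n. [:- ?d j, 1:]" and ?q = "monom 1 n + 1 :: complex poly"
  have q: "degree ?q = n" "lead_coeff ?q = 1"
    using assms by (simp_all add: degree_add_eq_left degree_monom_eq)
  have "?p = ?q"
  \<comment> \<open>Both polynomials are monic of degree \<open>n\<close> and vanish at the same
    \<open>n\<close> distinct points.\<close>
  proof (rule poly_eqI_degree_lead_coeff)
    show "n \<le> card (?d ` {..<n})"
      using inj_on_neg_cis_theta[OF assms] by (simp add: card_image)
    show "degree ?p \<le> n"
      by (simp add: degree_prod_eq_sum_degree)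
    show "degree ?q \<le> n"
      using q by simp
    show "coeff ?p n = coeff ?q n"
      using lead_coeff_prod[of "\<lambda>j. [:- ?d j, 1:]" "{..<n}"] q
      by (simp add: degree_prod_eq_sum_degree)
    show "poly ?p z = poly ?q z" if "z \<in> ?d ` {..<n}" for z
      using that neg_cis_theta_power[OF assms]
      by (auto simp: poly_prod poly_monom prod_zero_iff)
  qed
  then have "poly ?p y = poly ?q y" by simp
  then show ?thesis
    by (simp add: poly_prod poly_monom add.commute)
qed

text \<open>Homogenise the factorisation of \<open>y ^ n + 1\<close> at \<open>y = v / u\<close>.
  For \<open>u = 0\<close> both sides are \<open>v ^ n\<close>, as \<open>0 ^ n = 0\<close> for
  \<open>n > 0\<close>.\<close>

lemma prod_binary_form:
  assumes "n > 0"
  shows "(\<Prod>j<n. v + u * cis (2 * theta n j)) = u ^ n + v ^ n"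
proof (cases "u = 0")
  case False
  have "(\<Prod>j<n. v + u * cis (2 * theta n j)) = (\<Prod>j<n. u * (v / u + cis (2 * theta n j)))"
    using False by (simp add: distrib_left)
  also have "\<dots> = u ^ n * ((v / u) ^ n + 1)"
    using prod_diff_neg_cis_theta[OF assms, of "v / u"] by (simp add: prod.distrib)
  also have "\<dots> = u ^ n + v ^ n"
    using False by (simp add: power_divide distrib_left)
  finally show ?thesis .
qed (use assms in simp)

text \<open>Euler's formulas for cosine and sine. The factor \<open>cis (- t)\<close> is pulled out
  because it has modulus 1 and disappears from norms.\<close>

lemma linear_form_cis:
  "z * complex_of_real (cos t) + w * complex_of_real (sin t)
     = cis (- t) * ((z + \<i> * w) + (z - \<i> * w) * cis (2 * t)) / 2"
proof -
  have "cis (- t) * ((z + \<i> * w) + (z - \<i> * w) * cis (2 * t))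
      = (z + \<i> * w) * cis (- t) + (z - \<i> * w) * (cis (- t) * cis (2 * t))"
    by (simp add: algebra_simps)
  also have "\<dots> = (z + \<i> * w) * cis (- t) + (z - \<i> * w) * cis t"
    by (simp add: cis_mult)
  also have "\<dots> = 2 * (z * of_real (cos t) + w * of_real (sin t))"
    by (simp add: complex_eq_iff algebra_simps)
  finally show ?thesis by simp
qed

lemma scalar_prod_avec:
  assumes "n \<ge> 2" "x \<in> carrier_vec n"
  shows "x \<bullet> map_vec of_real (avec n j)
       = x $ 0 * of_real (cos (theta n j)) + x $ 1 * of_real (sin (theta n j))"
proof -
  have "x \<bullet> map_vec of_real (avec n j) = (\<Sum>k\<in>{0..<n}. x $ k * of_real (avec n j $ k))"
    by (simp add: scalar_prod_def avec_def)
  also have "\<dots> = (\<Sum>k\<in>{0,1}. x $ k * of_real (avec n j $ k))"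
    by (rule sum.mono_neutral_right) (use assms in \<open>auto simp: avec_def\<close>)
  also have "\<dots> = x $ 0 * of_real (cos (theta n j)) + x $ 1 * of_real (sin (theta n j))"
    using assms by (simp add: avec_def)
  finally show ?thesis .
qed

lemma norm_prod_linear_forms:
  fixes z w :: complex
  assumes "n > 0"
  shows "norm (\<Prod>j<n. z * of_real (cos (theta n j)) + w * of_real (sin (theta n j)))
       = norm ((z - \<i> * w) ^ n + (z + \<i> * w) ^ n) / 2 ^ n"
proof -
  have "norm (\<Prod>j<n. z * of_real (cos (theta n j)) + w * of_real (sin (theta n j)))
      = norm (\<Prod>j<n. (z + \<i> * w) + (z - \<i> * w) * cis (2 * theta n j)) / 2 ^ n"
    unfolding linear_form_cis
    by (simp add: norm_mult norm_divide prod_dividef prod.distrib norm_power flip: prod_norm)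
  then show ?thesis
    using prod_binary_form[OF assms] by simp
qed

lemma norm_Pn_complex:
  fixes x :: "complex vec"
  assumes "n \<ge> 2" "x \<in> carrier_vec n"
  shows "norm (Pn n x) = norm ((x $ 0 - \<i> * x $ 1) ^ n + (x $ 0 + \<i> * x $ 1) ^ n) / 2 ^ n"
  using assms norm_prod_linear_forms[of n] by (simp add: Pn_def scalar_prod_avec)

lemma norm_Pn_real:
  fixes x :: "real vec"
  assumes "n \<ge> 2" "x \<in> carrier_vec n"
  shows "norm (Pn n x)
       = norm ((x $ 0 - \<i> * x $ 1) ^ n + (x $ 0 + \<i> * x $ 1) ^ n) / 2 ^ n"
proof -
  have "norm (Pn n x) = norm (complex_of_real (Pn n x))"
    by simp
  also have "complex_of_real (Pn n x)
      = (\<Prod>j<n. of_real (x $ 0) * of_real (cos (theta n j))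
             + of_real (x $ 1) * of_real (sin (theta n j)))"
    unfolding Pn_def scalar_prod_avec[OF assms] by simp
  finally show ?thesis
    using assms norm_prod_linear_forms[of n] by simp
qed

lemma unit_sphere_le:
  fixes x :: "'a::real_normed_field vec"
  assumes "n \<ge> 2" "x \<in> unit_sphere n"
  shows "(norm (x $ 0))\<^sup>2 + (norm (x $ 1))\<^sup>2 \<le> 1"
proof -
  have "(\<Sum>k\<in>{0,1}. (norm (x $ k))\<^sup>2) \<le> (\<Sum>k<n. (norm (x $ k))\<^sup>2)"
    by (rule sum_mono2) (use assms in auto)
  also have "\<dots> = 1"
    using assms by (simp add: unit_sphere_def L2_set_def)
  finally show ?thesis by simp
qed

lemma vec_in_unit_sphere:
  fixes a b :: "'a::real_normed_field"
  assumes "n \<ge> 2" "(norm a)\<^sup>2 + (norm b)\<^sup>2 = 1"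
  shows "vec n (\<lambda>k. if k = 0 then a else if k = 1 then b else 0) \<in> unit_sphere n"
    (is "?x \<in> _")
proof -
  have "(\<Sum>k<n. (norm (?x $ k))\<^sup>2) = (\<Sum>k\<in>{0,1}. (norm (?x $ k))\<^sup>2)"
    by (rule sum.mono_neutral_right) (use assms in auto)
  also have "\<dots> = 1"
    using assms by simp
  finally show ?thesis
    by (simp add: unit_sphere_def L2_set_def)
qed

text \<open>A bound that is attained is the supremum, so boundedness and nonemptiness need no
  separate check.\<close>

lemma sphere_norm_eqI:
  assumes "\<And>x. x \<in> unit_sphere n \<Longrightarrow> norm (f x) \<le> c"
    and "x0 \<in> unit_sphere n" "norm (f x0) = c"
  shows "sphere_norm n f = c"
  unfolding sphere_norm_def using assms by (intro cSup_eq_maximum) auto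

text \<open>Each of \<open>a\<close> and \<open>b\<close> is at most \<open>sqrt 2\<close>. Bounding
  all but two factors of each power this way leaves
  \<open>a\<^sup>2 + b\<^sup>2 \<le> 2\<close>.\<close>

lemma power_add_power_le:
  fixes a b :: real
  assumes "n \<ge> 2" "a \<ge> 0" "b \<ge> 0" "a\<^sup>2 + b\<^sup>2 \<le> 2"
  shows "a ^ n + b ^ n \<le> sqrt 2 ^ n"
proof -
  obtain m where m: "n = m + 2"
    using assms(1) by (metis add.commute le_Suc_ex)
  have le: "c ^ n \<le> c\<^sup>2 * sqrt 2 ^ m" if "c \<ge> 0" "c\<^sup>2 \<le> 2" for c :: real
  proof -
    have "c \<le> sqrt 2"
      using that by (simp add: real_le_rsqrt)
    then show ?thesis
      unfolding m power_add using that
      by (subst mult.commute) (intro mult_left_mono power_mono, auto)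
  qed
  have "a\<^sup>2 \<le> 2" "b\<^sup>2 \<le> 2"
    using assms(4) zero_le_power2[of a] zero_le_power2[of b] by linarith+
  then have "a ^ n + b ^ n \<le> (a\<^sup>2 + b\<^sup>2) * sqrt 2 ^ m"
    using le[of a] le[of b] assms by (simp add: distrib_right)
  also have "\<dots> \<le> 2 * sqrt 2 ^ m"
    using assms(4) by (intro mult_right_mono) auto
  also have "\<dots> = sqrt 2 ^ n"
    by (simp add: m power_add)
  finally show ?thesis .
qed

text \<open>The parallelogram law for \<open>z\<close> and \<open>\<i> * w\<close>, whose norm is
  that of \<open>w\<close>.\<close>

lemma norm_add_ii_parallelogram:
  fixes z w :: complex
  shows "(norm (z - \<i> * w))\<^sup>2 + (norm (z + \<i> * w))\<^sup>2 = 2 * ((norm z)\<^sup>2 + (norm w)\<^sup>2)"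
  unfolding cmod_power2 by (simp add: power2_eq_square algebra_simps)

lemma sphere_norm_Pn_complex:
  assumes "n \<ge> 2"
  shows "sphere_norm n (Pn n :: complex vec \<Rightarrow> complex) = (sqrt 2 / 2) ^ n"
proof (rule sphere_norm_eqI)
  fix x :: "complex vec"
  assume x: "x \<in> unit_sphere n"
  let ?u = "x $ 0 - \<i> * x $ 1" and ?v = "x $ 0 + \<i> * x $ 1"
  have "norm (?u ^ n + ?v ^ n) \<le> norm ?u ^ n + norm ?v ^ n"
    by (metis norm_triangle_ineq norm_power)
  also have "\<dots> \<le> sqrt 2 ^ n"
    using assms unit_sphere_le[OF assms x] norm_add_ii_parallelogram[of "x $ 0" "x $ 1"]
    by (intro power_add_power_le) auto
  finally show "norm (Pn n x) \<le> (sqrt 2 / 2) ^ n"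
    using assms x by (simp add: norm_Pn_complex unit_sphere_def power_divide divide_right_mono)
next
  \<comment> \<open>Taking \<open>w = \<i> * z\<close> makes \<open>z + \<i> * w\<close> vanish and
    \<open>z - \<i> * w = 2 * z\<close>; the norm condition then allows
    \<open>z = sqrt 2 / 2\<close>.\<close>
  let ?r = "complex_of_real (sqrt 2 / 2)"
  let ?x = "vec n (\<lambda>k. if k = 0 then ?r else if k = 1 then \<i> * ?r else 0)"
  show "?x \<in> unit_sphere n"
    using assms by (intro vec_in_unit_sphere) (auto simp: norm_mult norm_divide power_divide)
  have "norm (Pn n ?x) = norm ((?r + ?r) ^ n) / 2 ^ n"
    using assms by (subst norm_Pn_complex) (auto simp: power_0_left simp flip: mult.assoc)
  also have "?r + ?r = of_real (sqrt 2)"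
    by simp
  finally show "norm (Pn n ?x) = (sqrt 2 / 2) ^ n"
    by (simp add: norm_power power_divide)
qed

lemma sphere_norm_Pn_real:
  assumes "n \<ge> 2"
  shows "sphere_norm n (Pn n :: real vec \<Rightarrow> real) = 2 / 2 ^ n"
proof (rule sphere_norm_eqI)
  fix x :: "real vec"
  assume x: "x \<in> unit_sphere n"
  let ?u = "complex_of_real (x $ 0) - \<i> * x $ 1" and ?v = "complex_of_real (x $ 0) + \<i> * x $ 1"
  \<comment> \<open>For real coordinates \<open>?u\<close> and \<open>?v\<close> are conjugate, so
    neither can grow at the expense of the other as in the complex case.\<close>
  have "norm ?u \<le> 1" "norm ?v \<le> 1"
    using unit_sphere_le[OF assms x] by (simp_all add: cmod_def)
  then have "norm ?u ^ n \<le> 1" "norm ?v ^ n \<le> 1"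
    by (simp_all add: power_le_one)
  then have "norm (?u ^ n + ?v ^ n) \<le> 2"
    using norm_triangle_ineq[of "?u ^ n" "?v ^ n"] unfolding norm_power by linarith
  then show "norm (Pn n x) \<le> 2 / 2 ^ n"
    unfolding norm_Pn_real[OF assms, of x] using x
    by (subst norm_Pn_real[OF assms]) (auto simp: unit_sphere_def intro: divide_right_mono)
next
  \<comment> \<open>Here both linear combinations equal 1, so their powers add up without
    cancellation.\<close>
  let ?x = "vec n (\<lambda>k. if k = 0 then 1 else if k = 1 then 0 else 0) :: real vec"
  show "?x \<in> unit_sphere n"
    using assms by (intro vec_in_unit_sphere) auto
  show "norm (Pn n ?x) = 2 / 2 ^ n"
    using assms by (subst norm_Pn_real) auto
qed

theorem mainTheorem3:
  fixes n :: nat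
  assumes "n \<ge> 2"
  shows "sphere_norm n (Pn n :: complex vec \<Rightarrow> complex)
       = 2 powr ((real n - 2) / 2) * sphere_norm n (Pn n :: real vec \<Rightarrow> real)"
proof -
  \<comment> \<open>The quotient of the two norms is \<open>sqrt 2 ^ n / 2\<close>.\<close>
  have "sqrt 2 ^ n = 2 powr (real n / 2)"
    using powr_powr[of 2 "1/2" "real n"] by (simp add: powr_half_sqrt powr_realpow)
  also have "\<dots> = 2 powr ((real n - 2) / 2) * 2"
    by (simp add: diff_divide_distrib powr_diff)
  finally show ?thesis
    using assms by (simp add: sphere_norm_Pn_complex sphere_norm_Pn_real power_divide)
qed

end
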